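(* Let $\lambda_i\in\mathbb{C}\setminus\{0\}$, let $m_i\in\mathbb{N}$ with $m_i>1$, and let $A_{\lambda_i}=\lambda_i I_{m_i}+N_{m_i}\in\mathbb{C}^{m_i\times m_i}$. Then for every $k\in\mathbb{N}$, $k\ge 1$, $$\|A_{\lambda_i}^k\|_2\le |\lambda_i|^k\,k^{m_i-1}\sum_{m=0}^{m_i-1}\frac{1}{|\lambda_i|^m}.$$ Moreover, if $|\lambda_i|\in(0,1)$, then $$\|A_{\lambda_i}^k\|_2\le m_i\,k^{m_i-1}|\lambda_i|^{k+1-m_i},$$ and for every $k\in\mathbb{N}$, $k\ge 1$, such that $$k>\frac{\ln(m_i)}{\ln(1/|\lambda_i|)}+\frac{(m_i-1)\ln(k)}{\ln(1/|\lambda_i|)}+(m_i-1)$$ one has $\|A_{\lambda_i}^k\|_2<1$.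
   Context: $\|\cdot\|_2$ is the operator norm induced by the Euclidean norm. $I_m$ is the $m\times m$ identity and $N_m$ is the $m\times m$ nilpotent shift matrix with ones on the first superdiagonal and zeros elsewhere. The matrix $A_{\lambda_i}$ represents the action of a matrix $A$ without null space on its generalized eigenspace $M_{\lambda_i}=N\big((A-\lambda_i I)^{m_i}\big)$, in a basis made of an eigenvector and successive generalized eigenvectors, where the eigenvalue $\lambda_i$ has algebraic multiplicity $m_i>1$ and geometric multiplicity $1$. *)

theory Defs
  imports
    "Jordan_Normal_Form.Matrix"
    "HOL-Analysis.L2_Norm"
begin

definition vec_norm2 :: "complex vec \<Rightarrow> real" where
  "vec_norm2 v = L2_set (\<lambda>i. cmod (v $ i)) {0..<dim_vec v}"

text \<open>
  The shape follows \<open>onorm\<close> of HOL-Analysis; the zero vector contributes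
  \<open>0 / 0 = 0\<close> and so does not affect the supremum.
\<close>

definition mat_norm2 :: "complex mat \<Rightarrow> real" where
  "mat_norm2 A = (SUP v\<in>carrier_vec (dim_col A). vec_norm2 (A *\<^sub>v v) / vec_norm2 v)"

definition shift_mat :: "nat \<Rightarrow> complex mat" where
  "shift_mat n = mat n n (\<lambda>(i, j). if j = Suc i then 1 else 0)"

end

(* The k-th power of the Jordan block lambda I + N is the sum over j < m of (k choose j) lambda^(k-j) N^j.
   Every power of the shift is a contraction of the Euclidean norm and (k choose j) <= k^(m-1), so the
   triangle inequality bounds the operator norm; the other two claims follow by estimating the
   resulting geometric sum by m / |lambda|^(m-1) and taking logarithms. *)
theory Submission
  imports Defs "Jordan_Normal_Form.Jordan_Normal_Form"
begin

text \<open>Reduces the supremum to a pointwise estimate. The sign condition on \<open>B\<close>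
  handles vectors of norm zero, whose quotient is 0 by the convention for division by zero.\<close>

lemma mat_norm2_le:
  assumes "B \<ge> 0"
    and "\<And>v. v \<in> carrier_vec (dim_col A) \<Longrightarrow> vec_norm2 (A *\<^sub>v v) \<le> B * vec_norm2 v"
  shows "mat_norm2 A \<le> B"
  unfolding mat_norm2_def
proof (rule cSUP_least)
  show "carrier_vec (dim_col A) \<noteq> ({} :: complex vec set)"
    using zero_carrier_vec by blast
next
  fix v :: "complex vec"
  assume v: "v \<in> carrier_vec (dim_col A)"
  have "vec_norm2 v \<ge> 0"
    by (simp add: vec_norm2_def L2_set_nonneg)
  then show "vec_norm2 (A *\<^sub>v v) / vec_norm2 v \<le> B"
    using assms(2)[OF v] assms(1) by (cases "vec_norm2 v = 0") (auto simp: pos_divide_le_eq)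
qed

lemma L2_set_sum_le:
  "L2_set (\<lambda>i. \<Sum>j\<in>J. f j i) I \<le> (\<Sum>j\<in>J. L2_set (f j) I)"
proof (induction J rule: infinite_finite_induct)
  case (insert x J)
  have "L2_set (\<lambda>i. \<Sum>j\<in>insert x J. f j i) I = L2_set (\<lambda>i. f x i + (\<Sum>j\<in>J. f j i)) I"
    using insert.hyps by simp
  also have "\<dots> \<le> L2_set (f x) I + L2_set (\<lambda>i. \<Sum>j\<in>J. f j i) I"
    by (rule L2_set_triangle_ineq)
  finally show ?case
    using insert by simp
qed (simp_all add: L2_set_def)

text \<open>This is the contraction property of the \<open>j\<close>-th power of the shift, phrased
  for the moduli of the entries: the shifted vector keeps the entries from index \<open>j\<close> on
  and fills up with zeros.\<close>

lemma L2_set_shift_le: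
  fixes f :: "nat \<Rightarrow> real"
  shows "L2_set (\<lambda>i. if i + j < n then f (i + j) else 0) {0..<n} \<le> L2_set f {0..<n}"
  unfolding L2_set_def
proof (rule real_sqrt_le_mono)
  have "(\<Sum>i = 0..<n. (if i + j < n then f (i + j) else 0)\<^sup>2) = (\<Sum>i = 0..<n - j. (f (i + j))\<^sup>2)"
    by (rule sum.mono_neutral_cong_right) auto
  \<comment> \<open>The upper end is not simplified to \<open>n\<close>: subtraction truncates, and
    for \<open>j > n\<close> this form still gives the empty range.\<close>
  also have "\<dots> = (\<Sum>i = j..<(n - j) + j. (f i)\<^sup>2)"
    using sum.shift_bounds_nat_ivl[of "\<lambda>i. (f i)\<^sup>2" 0 j "n - j"] by simp
  also have "\<dots> \<le> (\<Sum>i = 0..<n. (f i)\<^sup>2)"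
    by (rule sum_mono2) auto
  finally show "(\<Sum>i = 0..<n. (if i + j < n then f (i + j) else 0)\<^sup>2) \<le> (\<Sum>i = 0..<n. (f i)\<^sup>2)" .
qed

text \<open>Gives access to \<open>jordan_block_pow\<close>, the closed form for the entries of the
  powers.\<close>

lemma jordan_block_eq_smult_one_plus_shift:
  "l \<cdot>\<^sub>m 1\<^sub>m n + shift_mat n = jordan_block n l"
  by (rule eq_matI) (auto simp: shift_mat_def jordan_block_def)

text \<open>The binomial expansion of the power, applied to \<open>v\<close>: an entry of the power
  depends only on its diagonal \<open>j = c - i\<close>. Padding with zeros makes the range of
  \<open>j\<close> independent of \<open>i\<close>, so that the sum can later be pulled out of the
  norm.\<close>

lemma jordan_block_pow_mult_vec:
  assumes "v \<in> carrier_vec n" "i < n"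
  shows "(jordan_block n l ^\<^sub>m k *\<^sub>v v) $ i =
    (\<Sum>j<n. of_nat (k choose j) * l ^ (k - j) * (if i + j < n then v $ (i + j) else (0::complex)))"
proof -
  let ?g = "\<lambda>j. of_nat (k choose j) * l ^ (k - j)"
  have "(jordan_block n l ^\<^sub>m k *\<^sub>v v) $ i =
      (\<Sum>c = 0..<n. (if i \<le> c then of_nat (k choose (c - i)) * l ^ (k + i - c) else 0) * v $ c)"
    using assms by (auto simp: jordan_block_pow scalar_prod_def intro!: sum.cong)
  also have "\<dots> = (\<Sum>c = i..<n. ?g (c - i) * v $ c)"
    by (rule sum.mono_neutral_cong_right) auto
  also have "\<dots> = (\<Sum>j = 0..<n - i. ?g j * v $ (i + j))"
    using sum.shift_bounds_nat_ivl[of "\<lambda>c. ?g (c - i) * v $ c" 0 i "n - i"] assms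
    by (simp add: add.commute)
  also have "\<dots> = (\<Sum>j<n. ?g j * (if i + j < n then v $ (i + j) else 0))"
    by (rule sum.mono_neutral_cong_left) auto
  finally show ?thesis .
qed

text \<open>Minkowski's inequality splits the norm along the diagonals \<open>j\<close>, and each
  shifted copy of \<open>v\<close> is no longer than \<open>v\<close>. What remains is a scalar
  sum.\<close>

lemma mat_norm2_jordan_block_pow_le:
  "mat_norm2 (jordan_block n l ^\<^sub>m k) \<le> (\<Sum>j<n. real (k choose j) * cmod l ^ (k - j))"
proof (rule mat_norm2_le)
  show "0 \<le> (\<Sum>j<n. real (k choose j) * cmod l ^ (k - j))"
    by (intro sum_nonneg) simp
next
  let ?J = "jordan_block n l ^\<^sub>m k"
  let ?b = "\<lambda>j. real (k choose j) * cmod l ^ (k - j)"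
  fix v :: "complex vec"
  assume "v \<in> carrier_vec (dim_col ?J)"
  then have v: "v \<in> carrier_vec n"
    by (simp add: jordan_block_pow)
  let ?s = "\<lambda>j i. if i + j < n then cmod (v $ (i + j)) else 0"
  have "vec_norm2 (?J *\<^sub>v v) = L2_set (\<lambda>i. cmod ((?J *\<^sub>v v) $ i)) {0..<n}"
    by (simp add: vec_norm2_def jordan_block_pow)
  also have "\<dots> \<le> L2_set (\<lambda>i. \<Sum>j<n. ?b j * ?s j i) {0..<n}"
  proof (rule L2_set_mono)
    fix i assume "i \<in> {0..<n}"
    then show "cmod ((?J *\<^sub>v v) $ i) \<le> (\<Sum>j<n. ?b j * ?s j i)"
      using v by (subst jordan_block_pow_mult_vec)
        (auto intro!: sum_norm_le simp: norm_mult norm_power)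
  qed auto
  also have "\<dots> \<le> (\<Sum>j<n. L2_set (\<lambda>i. ?b j * ?s j i) {0..<n})"
    by (rule L2_set_sum_le)
  also have "\<dots> = (\<Sum>j<n. ?b j * L2_set (?s j) {0..<n})"
    by (intro sum.cong refl, subst L2_set_right_distrib) auto
  also have "\<dots> \<le> (\<Sum>j<n. ?b j * vec_norm2 v)"
    using v by (intro sum_mono mult_left_mono)
      (auto simp: vec_norm2_def L2_set_shift_le[where f = "\<lambda>i. cmod (v $ i)"])
  also have "\<dots> = (\<Sum>j<n. ?b j) * vec_norm2 v"
    by (simp add: sum_distrib_right)
  finally show "vec_norm2 (?J *\<^sub>v v) \<le> (\<Sum>j<n. ?b j) * vec_norm2 v" .
qed

theorem theorem1:
  fixes l :: complex and m :: nat and A :: "complex mat"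
  assumes "l \<noteq> 0"
    and "m > 1"
    and "A = l \<cdot>\<^sub>m 1\<^sub>m m + shift_mat m"
  shows "(\<forall>k::nat. k \<ge> 1 \<longrightarrow>
            mat_norm2 (A ^\<^sub>m k) \<le>
              cmod l ^ k * real k ^ (m - 1) * (\<Sum>j = 0..m - 1. 1 / cmod l ^ j)) \<and>
         (cmod l \<in> {0<..<1} \<longrightarrow>
            (\<forall>k::nat. k \<ge> 1 \<longrightarrow>
              mat_norm2 (A ^\<^sub>m k) \<le>
                real m * real k ^ (m - 1) * cmod l powi (int k + 1 - int m)) \<and>
            (\<forall>k::nat. k \<ge> 1 \<longrightarrow>
              real k > ln (real m) / ln (1 / cmod l)
                       + (real m - 1) * ln (real k) / ln (1 / cmod l)
                       + (real m - 1) \<longrightarrow>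
              mat_norm2 (A ^\<^sub>m k) < 1))"
proof (intro conjI allI impI)
  have A: "A = jordan_block m l"
    using assms(3) by (simp add: jordan_block_eq_smult_one_plus_shift)
  have l0: "cmod l > 0"
    using assms(1) by simp
  show sum_bound: "mat_norm2 (A ^\<^sub>m k) \<le>
      cmod l ^ k * real k ^ (m - 1) * (\<Sum>j = 0..m - 1. 1 / cmod l ^ j)" if "k \<ge> 1" for k
  proof -
    have "real (k choose j) * cmod l ^ (k - j) \<le> cmod l ^ k * real k ^ (m - 1) * (1 / cmod l ^ j)"
      if "j < m" for j
    \<comment> \<open>For \<open>j > k\<close> the exponent \<open>k - j\<close> truncates to 0, but
      the binomial coefficient vanishes, so the bound holds trivially.\<close>
    proof (cases "j \<le> k")
      case True
      have "real (k choose j) \<le> real (k ^ j)"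
        using binomial_le_pow[OF True] of_nat_mono by blast
      also have "\<dots> \<le> real k ^ (m - 1)"
        using \<open>k \<ge> 1\<close> \<open>j < m\<close> by (auto intro!: power_increasing)
      finally have "real (k choose j) * (cmod l ^ k / cmod l ^ j)
          \<le> real k ^ (m - 1) * (cmod l ^ k / cmod l ^ j)"
        by (intro mult_right_mono) auto
      then show ?thesis
        using True l0 by (simp add: power_diff mult_ac)
    qed (simp add: binomial_eq_0)
    then have "(\<Sum>j<m. real (k choose j) * cmod l ^ (k - j))
        \<le> (\<Sum>j<m. cmod l ^ k * real k ^ (m - 1) * (1 / cmod l ^ j))"
      by (intro sum_mono) simp
    also have "\<dots> = cmod l ^ k * real k ^ (m - 1) * (\<Sum>j<m. 1 / cmod l ^ j)"
      by (simp add: sum_distrib_left)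
    finally have "mat_norm2 (A ^\<^sub>m k) \<le> cmod l ^ k * real k ^ (m - 1) * (\<Sum>j<m. 1 / cmod l ^ j)"
      using mat_norm2_jordan_block_pow_le[of m l k] unfolding A by linarith
    moreover have "{..<m} = {0..m - 1}"
      using assms(2) by auto
    ultimately show ?thesis
      by simp
  qed
  show geom_bound: "mat_norm2 (A ^\<^sub>m k) \<le>
      real m * real k ^ (m - 1) * cmod l powi (int k + 1 - int m)"
    if l1: "cmod l \<in> {0<..<1}" and "k \<ge> 1" for k
  proof -
    \<comment> \<open>As \<open>cmod l < 1\<close>, the last of the \<open>m\<close> summands is the
      largest.\<close>
    have "(\<Sum>j = 0..m - 1. 1 / cmod l ^ j) \<le> (\<Sum>j = 0..m - 1. 1 / cmod l ^ (m - 1))"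
      using l1 by (intro sum_mono divide_left_mono power_decreasing) auto
    also have "\<dots> = real m / cmod l ^ (m - 1)"
      using assms(2) by simp
    finally have "cmod l ^ k * real k ^ (m - 1) * (\<Sum>j = 0..m - 1. 1 / cmod l ^ j)
        \<le> cmod l ^ k * real k ^ (m - 1) * (real m / cmod l ^ (m - 1))"
      by (intro mult_left_mono) auto
    also have "\<dots> = real m * real k ^ (m - 1) * (cmod l ^ k / cmod l ^ (m - 1))"
      by simp
    \<comment> \<open>An integer power, since the exponent is negative when
      \<open>k < m - 1\<close>.\<close>
    also have "cmod l ^ k / cmod l ^ (m - 1) = cmod l powi (int k - int (m - 1))"
      using l0 by (simp add: power_int_diff)
    also have "int k - int (m - 1) = int k + 1 - int m"
      using assms(2) by simp
    finally show ?thesis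
      using sum_bound[OF \<open>k \<ge> 1\<close>] by linarith
  qed
  show "mat_norm2 (A ^\<^sub>m k) < 1"
    if l1: "cmod l \<in> {0<..<1}" and "k \<ge> 1"
      and k: "real k > ln (real m) / ln (1 / cmod l)
        + (real m - 1) * ln (real k) / ln (1 / cmod l) + (real m - 1)" for k
  proof -
    let ?c = "real m * real k ^ (m - 1) * cmod l powi (int k + 1 - int m)"
    have c0: "?c > 0"
      using l0 assms(2) \<open>k \<ge> 1\<close> by simp
    have L: "ln (1 / cmod l) > 0"
      using l1 by simp
    \<comment> \<open>Multiplied by the positive number \<open>ln (1 / cmod l)\<close>, the
      hypothesis on \<open>k\<close> says exactly that \<open>ln ?c\<close> is negative.\<close>
    have "(ln (real m) + (real m - 1) * ln (real k)) / ln (1 / cmod l) < real k - (real m - 1)"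
      using k unfolding add_divide_distrib by linarith
    then have "ln (real m) + (real m - 1) * ln (real k) < (real k - (real m - 1)) * ln (1 / cmod l)"
      using L by (simp only: pos_divide_less_eq)
    moreover have "ln (cmod l powi (int k + 1 - int m)) = (real k - (real m - 1)) * ln (cmod l)"
    proof -
      \<comment> \<open>Passing to a real exponent lets \<open>ln_powr\<close> extract it, whatever
        its sign.\<close>
      have "cmod l powi (int k + 1 - int m) = cmod l powr (real k - (real m - 1))"
        using l0 powr_real_of_int'[of "cmod l" "int k + 1 - int m"] by (simp add: algebra_simps)
      then show ?thesis
        by (simp add: ln_powr)
    qed
    then have "ln ?c = ln (real m) + (real m - 1) * ln (real k)
        + (real k - (real m - 1)) * ln (cmod l)"
      using l0 assms(2) \<open>k \<ge> 1\<close> by (simp add: ln_mult ln_realpow of_nat_diff)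
    moreover have "ln (1 / cmod l) = - ln (cmod l)"
      using l0 by (simp add: ln_div)
    ultimately have "ln ?c < 0"
      by simp
    then have "?c < 1"
      using c0 by simp
    then show ?thesis
      using geom_bound[OF l1 \<open>k \<ge> 1\<close>] by linarith
  qed
qed

end
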